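(* There is an absolute constant $C>0$ such that for any finite graph $G$ (weighted, undirected), $$\rho(G) < C\,\tau_\infty(G)\,\log\log\frac{1}{\pi_*(G)},$$ where $\tau_\infty(G)$ is the $L^\infty$ mixing time (with $\epsilon=\tfrac12$) of the continuous-time random walk on $G$, $\rho(G)$ is the spectral profile integral of $G$, and $\pi_*(G)$ is the minimal stationary measure of a nonempty set of vertices.
   Context: A finite weighted undirected graph is a finite vertex set $G$ together with a weight function $\omega:G\times G\to[0,\infty)$ satisfying $\omega(x,y)=\omega(y,x)$. Put $\omega(x)=\sum_{z}\omega(x,z)$. Define the stochastic matrix $K(x,y)=\omega(x,y)/\omega(x)$, the stationary measure $\pi(x)=\omega(x)/\sum_{y}\omega(y)$, $\pi(A)=\sum_{x\in A}\pi(x)$ for $A\subset G$, and $\pi_*=\pi_*(G)=\min_{\emptyset\ne A\subset G}\pi(A)$. The Laplacian is $\Delta=I-K$, acting by $(\Delta f)(x)=f(x)-\sum_y K(x,y)f(y)$. Write $\langle f,g\rangle=\sum_x f(x)g(x)\pi(x)$ and, for $f\ge 0$, $\|f\|_p^p=\sum_x f(x)^p\pi(x)$. For nonempty $A\subset G$ let $$\lambda(A)=\inf\left\{\frac{\langle \Delta f,f\rangle}{\|f\|_2^2-\|f\|_1^2} : \operatorname{supp} f\subset A,\ f\ge 0,\ f\not\equiv\text{const}\right\}.$$ The spectral profile is $\Lambda(r)=\inf\{\lambda(A): A\subset G,\ 0<\pi(A)\le r\}$, defined for all $r\ge\pi_*$. The spectral profile integral is $$\rho=\rho(G)=\int_{4\pi_*}^{8}\frac{2\,dr}{r\Lambda(r)}.$$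 The continuous-time random walk on $G$ has transition matrix $H_t=e^{-t\Delta}=e^{-t}\sum_{n\ge0}\frac{t^n}{n!}K^n$, and its $L^\infty$ mixing time (at $\epsilon=\tfrac12$) is $$\tau_\infty=\tau_\infty(G)=\inf\left\{t>0:\ \sup_{x,y\in G}\left|\frac{H_t(x,y)-\pi(y)}{\pi(y)}\right|\le\frac12\right\}.$$
   Formalization: Graphs are connected with at least two vertices (else mixing time and profile integral are infinite, or log log 1 is undefined), and log log(1/π_* ) is read as max(1, log log(1/π_* )), since it is negative for two equal-weight vertices (π_*=1/2); vertices are natural numbers. *)

theory Defs
  imports "HOL-Analysis.Analysis"
begin

locale weighted_graph =
  fixes V :: "'a set" and \<omega> :: "'a \<Rightarrow> 'a \<Rightarrow> real"
  assumes finite_V: "finite V"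
    and nonempty_V: "V \<noteq> {}"
    and weight_nonneg: "\<And>x y. x \<in> V \<Longrightarrow> y \<in> V \<Longrightarrow> 0 \<le> \<omega> x y"
    and weight_sym: "\<And>x y. x \<in> V \<Longrightarrow> y \<in> V \<Longrightarrow> \<omega> x y = \<omega> y x"

definition connected_graph :: "'a set \<Rightarrow> ('a \<Rightarrow> 'a \<Rightarrow> real) \<Rightarrow> bool" where
  "connected_graph V \<omega> \<longleftrightarrow>
     (\<forall>x\<in>V. \<forall>y\<in>V. (x, y) \<in> {(u, v). u \<in> V \<and> v \<in> V \<and> 0 < \<omega> u v}\<^sup>*)"

definition vertex_weight :: "'a set \<Rightarrow> ('a \<Rightarrow> 'a \<Rightarrow> real) \<Rightarrow> 'a \<Rightarrow> real" where
  "vertex_weight V \<omega> x = (\<Sum>z\<in>V. \<omega> x z)"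

(* Only meaningful when vertex_weight V \<omega> x > 0.  This holds at every vertex of a
   connected graph with at least two vertices. *)
definition transition :: "'a set \<Rightarrow> ('a \<Rightarrow> 'a \<Rightarrow> real) \<Rightarrow> 'a \<Rightarrow> 'a \<Rightarrow> real" where
  "transition V \<omega> x y = \<omega> x y / vertex_weight V \<omega> x"

definition stationary :: "'a set \<Rightarrow> ('a \<Rightarrow> 'a \<Rightarrow> real) \<Rightarrow> 'a \<Rightarrow> real" where
  "stationary V \<omega> x = vertex_weight V \<omega> x / (\<Sum>y\<in>V. vertex_weight V \<omega> y)"

definition stationary_set :: "'a set \<Rightarrow> ('a \<Rightarrow> 'a \<Rightarrow> real) \<Rightarrow> 'a set \<Rightarrow> real" where
  "stationary_set V \<omega> A = (\<Sum>x\<in>A. stationary V \<omega> x)"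

definition min_stationary :: "'a set \<Rightarrow> ('a \<Rightarrow> 'a \<Rightarrow> real) \<Rightarrow> real" where
  "min_stationary V \<omega> = Min (stationary_set V \<omega> ` {A. A \<subseteq> V \<and> A \<noteq> {}})"

definition laplacian :: "'a set \<Rightarrow> ('a \<Rightarrow> 'a \<Rightarrow> real) \<Rightarrow> ('a \<Rightarrow> real) \<Rightarrow> 'a \<Rightarrow> real" where
  "laplacian V \<omega> f x = f x - (\<Sum>y\<in>V. transition V \<omega> x y * f y)"

definition graph_inner ::
    "'a set \<Rightarrow> ('a \<Rightarrow> 'a \<Rightarrow> real) \<Rightarrow> ('a \<Rightarrow> real) \<Rightarrow> ('a \<Rightarrow> real) \<Rightarrow> real" where
  "graph_inner V \<omega> f g = (\<Sum>x\<in>V. f x * g x * stationary V \<omega> x)"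

(* Used for p \<ge> 1 and f \<ge> 0 on V, so no absolute value is taken. *)
definition Lp_norm :: "'a set \<Rightarrow> ('a \<Rightarrow> 'a \<Rightarrow> real) \<Rightarrow> nat \<Rightarrow> ('a \<Rightarrow> real) \<Rightarrow> real" where
  "Lp_norm V \<omega> p f = root p (\<Sum>x\<in>V. f x ^ p * stationary V \<omega> x)"

(* A function on the graph is a function on the whole type of which only the values
   on V matter; support, sign and non-constancy are therefore all taken relative to V. *)
definition admissible :: "'a set \<Rightarrow> 'a set \<Rightarrow> ('a \<Rightarrow> real) set" where
  "admissible V A =
     {f. {x \<in> V. f x \<noteq> 0} \<subseteq> A \<and> (\<forall>x\<in>V. 0 \<le> f x) \<and> \<not> f constant_on V}"

(* For a connected graph with at least two vertices and {} \<noteq> A \<subseteq> V, the infimum is over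
   a nonempty set of nonnegative reals: a non-constant f has positive variance, so the
   denominator does not vanish.  The infimum itself is positive. *)
definition set_lambda :: "'a set \<Rightarrow> ('a \<Rightarrow> 'a \<Rightarrow> real) \<Rightarrow> 'a set \<Rightarrow> real" where
  "set_lambda V \<omega> A =
     (INF f \<in> admissible V A.
        graph_inner V \<omega> (laplacian V \<omega> f) f / ((Lp_norm V \<omega> 2 f)\<^sup>2 - (Lp_norm V \<omega> 1 f)\<^sup>2))"

(* Meaningful for r \<ge> min_stationary V \<omega>, where the index set is finite and nonempty. *)
definition spectral_profile :: "'a set \<Rightarrow> ('a \<Rightarrow> 'a \<Rightarrow> real) \<Rightarrow> real \<Rightarrow> real" where
  "spectral_profile V \<omega> r =
     (INF A \<in> {A. A \<subseteq> V \<and> 0 < stationary_set V \<omega> A \<and> stationary_set V \<omega> A \<le> r}.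
        set_lambda V \<omega> A)"

(* For a connected graph with at least two vertices the spectral profile is a positive
   decreasing step function on the (nondegenerate) interval of integration, so the
   integrand is bounded and measurable and the integral is a genuine one. *)
definition spectral_profile_integral :: "'a set \<Rightarrow> ('a \<Rightarrow> 'a \<Rightarrow> real) \<Rightarrow> real" where
  "spectral_profile_integral V \<omega> =
     (LBINT r:{4 * min_stationary V \<omega>..8}. 2 / (r * spectral_profile V \<omega> r))"

primrec transition_power ::
    "'a set \<Rightarrow> ('a \<Rightarrow> 'a \<Rightarrow> real) \<Rightarrow> nat \<Rightarrow> 'a \<Rightarrow> 'a \<Rightarrow> real" where
  "transition_power V \<omega> 0 x y = (if x = y then 1 else 0)"
| "transition_power V \<omega> (Suc n) x y =
     (\<Sum>z\<in>V. transition V \<omega> x z * transition_power V \<omega> n z y)"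

definition heat_kernel ::
    "'a set \<Rightarrow> ('a \<Rightarrow> 'a \<Rightarrow> real) \<Rightarrow> real \<Rightarrow> 'a \<Rightarrow> 'a \<Rightarrow> real" where
  "heat_kernel V \<omega> t x y =
     exp (- t) * (\<Sum>n. t ^ n / fact n * transition_power V \<omega> n x y)"

(* For a connected graph the set of admissible times is nonempty. *)
definition mixing_time :: "'a set \<Rightarrow> ('a \<Rightarrow> 'a \<Rightarrow> real) \<Rightarrow> real" where
  "mixing_time V \<omega> =
     Inf {t. 0 < t \<and>
       (SUP (x, y) \<in> V \<times> V.
          \<bar>(heat_kernel V \<omega> t x y - stationary V \<omega> y) / stationary V \<omega> y\<bar>) \<le> 1 / 2}"

(* Two conventions are needed to state bounds uniform over all finite graphs.

   Vertices are natural numbers whenever a constant has to be independent of the graph: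
   every finite graph is isomorphic to one with V \<subseteq> \<nat>, whereas a type variable for the
   vertices would be fixed outside the existential quantifier over the constant.

   An iterated logarithm in an upper bound is read as at least 1, that is as
   max 1 (ln (ln (1 / min_stationary V \<omega>))).  The bare expression ln (ln (1 / p)) is negative
   for p = 1 / 2 (two vertices of equal weight) and tends to 0 as p increases to 1 / exp 1,
   while the spectral profile integral stays positive, so that no constant would do.
   Both expressions agree when p \<le> exp (- exp 1). *)

end

theory Submission
  imports Defs
begin

text \<open>
  Write \<open>\<tau>\<close> for the mixing time, \<open>p\<close> for the minimal stationary measure and
  \<open>E f = \<langle>\<Delta> f, f\<rangle>\<close>. The whole argument is a pointwise lower bound for the spectral profile,
  of order \<open>\<Lambda> r \<ge> max (ln 2) (ln (2 / (3 r))) / \<tau>\<close>. Once it is known, the substitution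
  \<open>r = exp (-s)\<close> turns the spectral profile integral into at most a constant multiple of
  \<open>\<tau>\<close> times the integral of \<open>1 / max 1 s\<close> up to \<open>s = ln (1 / p)\<close>, which is where the iterated
  logarithm comes from.

  The bound on \<open>\<Lambda>\<close> compares two estimates of \<open>\<langle>H\<^sub>t f, f\<rangle>\<close> at a time \<open>t\<close> at which the walk has
  mixed. From below, \<open>\<langle>H\<^sub>t f, f\<rangle> \<ge> \<parallel>f\<parallel>\<^sup>2 exp (- t E f / \<parallel>f\<parallel>\<^sup>2)\<close> for every \<open>f\<close>: this is Jensen's
  inequality for the spectral measure of \<open>f\<close>, and is obtained here without diagonalising
  \<open>\<Delta>\<close>, from the log-convexity of \<open>t \<mapsto> \<langle>H\<^sub>t f, f\<rangle>\<close> (lemma \<open>inner_heat_ge_exp_energy\<close>). From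
  above, mixing says that \<open>H\<^sub>t x y\<close> lies between \<open>\<pi> y / 2\<close> and \<open>3 \<pi> y / 2\<close>. If \<open>f \<ge> 0\<close> is
  supported in \<open>A\<close>, this gives \<open>\<langle>H\<^sub>t f, f\<rangle> \<le> 3/2 \<parallel>f\<parallel>\<^sub>1\<^sup>2 \<le> 3/2 \<pi>(A) \<parallel>f\<parallel>\<^sub>2\<^sup>2\<close> by Cauchy-Schwarz, so
  \<open>t E f \<ge> ln (2 / (3 \<pi>(A))) \<parallel>f\<parallel>\<^sub>2\<^sup>2\<close> (lemma \<open>energy_ge_supported\<close>). Applied to \<open>f\<close> minus its
  mean, where only the deviation \<open>H\<^sub>t x y - \<pi> y\<close> contributes, the same comparison gives
  \<open>t E f \<ge> ln 2 (\<parallel>f\<parallel>\<^sub>2\<^sup>2 - \<parallel>f\<parallel>\<^sub>1\<^sup>2)\<close> (lemma \<open>energy_ge_variance\<close>), which covers the sets \<open>A\<close> that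
  are not small.

  The two estimates are averaged with weights 1 and 4 into the single expression
  \<open>ln (32 / (3 r)) / 5\<close>, positive on the whole range \<open>r \<le> 8\<close>, so that
  \<open>1 / (r ln (32 / (3 r)))\<close> can be integrated in closed form. Since \<open>\<tau>\<close> is an infimum, one also
  has to know that some time mixes; this is Doeblin's contraction argument
  (lemma \<open>exists_mixed\<close>).
\<close>

section \<open>Log-convex functions lie above their exponential tangents\<close>

text \<open>
  Dividing \<open>\<phi>\<close> by its exponential tangent at 0 gives a function \<open>\<psi>\<close> with the same midpoint
  property and derivative 0 at 0. By the inequality of the means, \<open>\<psi> - \<psi> 0\<close> at least doubles
  from \<open>s / 2\<close> to \<open>s\<close>; comparing \<open>t\<close> with \<open>t / 2 ^ n\<close> and letting \<open>n\<close> tend to infinity, the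
  vanishing derivative forces \<open>\<psi> t \<ge> \<psi> 0\<close>. For the heat semigroup, the midpoint
  inequality with 0 as one end point is Cauchy-Schwarz.
\<close>

lemma log_convex_above_exp_tangent:
  fixes \<phi> :: "real \<Rightarrow> real"
  assumes midpoint: "\<And>s. 0 \<le> s \<Longrightarrow> (\<phi> (s / 2))\<^sup>2 \<le> \<phi> s * \<phi> 0"
    and nonneg: "\<And>s. 0 \<le> s \<Longrightarrow> 0 \<le> \<phi> s"
    and pos: "0 < \<phi> 0"
    and deriv: "(\<phi> has_real_derivative d) (at 0)"
    and t: "0 < t"
  shows "\<phi> 0 * exp (t * d / \<phi> 0) \<le> \<phi> t"
proof -
  define c where "c = d / \<phi> 0"
  define \<psi> where "\<psi> s = exp (- (c * s)) * \<phi> s" for s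
  have \<psi>0: "\<psi> 0 = \<phi> 0"
    by (simp add: \<psi>_def)
  have \<psi>_deriv: "(\<psi> has_real_derivative 0) (at 0)"
    unfolding \<psi>_def using pos
    by (auto intro!: derivative_eq_intros deriv simp: c_def)
  have mid: "2 * (\<psi> (s / 2) - \<phi> 0) \<le> \<psi> s - \<phi> 0" if s: "0 \<le> s" for s
  proof -
    have e: "(exp (- (c * (s / 2))))\<^sup>2 = exp (- (c * s))"
      by (simp flip: exp_double)
    have "(\<psi> (s / 2))\<^sup>2 = exp (- (c * s)) * (\<phi> (s / 2))\<^sup>2"
      unfolding \<psi>_def power_mult_distrib e ..
    also have "\<dots> \<le> exp (- (c * s)) * (\<phi> s * \<phi> 0)"
      using midpoint[OF s] by (intro mult_left_mono) auto
    finally have "(\<psi> (s / 2))\<^sup>2 \<le> \<psi> s * \<phi> 0"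
      by (simp add: \<psi>_def mult.assoc)
    moreover have "4 * (\<psi> s * \<phi> 0) \<le> (\<psi> s + \<phi> 0)\<^sup>2"
      using zero_le_power2[of "\<psi> s - \<phi> 0"] by (simp add: power2_eq_square algebra_simps)
    ultimately have "(2 * \<psi> (s / 2))\<^sup>2 \<le> (\<psi> s + \<phi> 0)\<^sup>2"
      by (simp add: power_mult_distrib)
    moreover have "0 \<le> \<psi> s + \<phi> 0"
      using nonneg[OF s] pos by (simp add: \<psi>_def)
    ultimately have "2 * \<psi> (s / 2) \<le> \<psi> s + \<phi> 0"
      by (rule power2_le_imp_le)
    then show ?thesis by simp
  qed
  have chain: "2 ^ n * (\<psi> (t / 2 ^ n) - \<phi> 0) \<le> \<psi> t - \<phi> 0" for n
  proof (induction n)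
    case (Suc n)
    have "2 ^ Suc n * (\<psi> (t / 2 ^ Suc n) - \<phi> 0) = 2 ^ n * (2 * (\<psi> (t / 2 ^ n / 2) - \<phi> 0))"
      by (simp add: field_simps)
    also have "\<dots> \<le> 2 ^ n * (\<psi> (t / 2 ^ n) - \<phi> 0)"
      using t by (intro mult_left_mono mid) auto
    finally show ?case using Suc by linarith
  qed simp
  have "(\<lambda>n. t / 2 ^ n) \<longlonglongrightarrow> 0"
    using LIMSEQ_divide_realpow_zero[of 2 t] by simp
  then have "filterlim (\<lambda>n. t / 2 ^ n) (at 0) sequentially"
    using t by (auto simp: filterlim_at)
  moreover have "((\<lambda>h. (\<psi> h - \<phi> 0) / h) \<longlongrightarrow> 0) (at 0)"
    using \<psi>_deriv by (simp add: DERIV_def \<psi>0)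
  ultimately have "(\<lambda>n. (\<psi> (t / 2 ^ n) - \<phi> 0) / (t / 2 ^ n)) \<longlonglongrightarrow> 0"
    by (rule filterlim_compose[rotated])
  then have "(\<lambda>n. t * ((\<psi> (t / 2 ^ n) - \<phi> 0) / (t / 2 ^ n))) \<longlonglongrightarrow> t * 0"
    by (rule tendsto_mult_left)
  then have "(\<lambda>n. 2 ^ n * (\<psi> (t / 2 ^ n) - \<phi> 0)) \<longlonglongrightarrow> 0"
    using t by (simp add: mult.commute)
  then have "0 \<le> \<psi> t - \<phi> 0"
    by (rule LIMSEQ_le_const2) (use chain in auto)
  then have "\<phi> 0 * exp (c * t) \<le> \<psi> t * exp (c * t)"
    by (intro mult_right_mono) auto
  also have "\<dots> = \<phi> t"
    by (simp add: \<psi>_def mult.commute mult.left_commute flip: exp_add)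
  finally show ?thesis
    by (simp add: c_def mult.commute)
qed

section \<open>The random walk on a connected weighted graph\<close>

locale connected_weighted_graph = weighted_graph V \<omega>
  for V :: "'a set" and \<omega> :: "'a \<Rightarrow> 'a \<Rightarrow> real" +
  assumes connected: "connected_graph V \<omega>"
    and two_vertices: "2 \<le> card V"
begin

abbreviation "\<pi> \<equiv> stationary V \<omega>"
abbreviation "K \<equiv> transition V \<omega>"
abbreviation "Kpow \<equiv> transition_power V \<omega>"
abbreviation "H \<equiv> heat_kernel V \<omega>"
abbreviation "ginner \<equiv> graph_inner V \<omega>"
abbreviation "energy f \<equiv> ginner (laplacian V \<omega> f) f"
abbreviation "mean f \<equiv> (\<Sum>x\<in>V. f x * \<pi> x)"

lemma exists_other_vertex: "\<exists>y\<in>V. y \<noteq> x"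
proof (rule ccontr)
  assume "\<not> ?thesis"
  then have "V \<subseteq> {x}" by auto
  then have "card V \<le> 1" using card_mono[of "{x}" V] by simp
  then show False using two_vertices by simp
qed

lemma vertex_weight_pos:
  assumes x: "x \<in> V" shows "0 < vertex_weight V \<omega> x"
proof -
  obtain y where y: "y \<in> V" "y \<noteq> x" using exists_other_vertex by auto
  have "(x, y) \<in> {(u, v). u \<in> V \<and> v \<in> V \<and> 0 < \<omega> u v}\<^sup>*"
    using connected x y by (auto simp: connected_graph_def)
  then obtain z where "z \<in> V" "0 < \<omega> x z"
    using y by (cases rule: converse_rtranclE) auto
  then show ?thesis
    unfolding vertex_weight_def using x finite_V weight_nonneg
    by (intro sum_pos2[of _ z]) auto
qed

lemma total_weight_pos: "0 < (\<Sum>y\<in>V. vertex_weight V \<omega> y)"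
  using finite_V nonempty_V vertex_weight_pos by (intro sum_pos) auto

lemma stationary_pos: "x \<in> V \<Longrightarrow> 0 < \<pi> x"
  using vertex_weight_pos total_weight_pos by (simp add: stationary_def)

lemma sum_stationary: "(\<Sum>x\<in>V. \<pi> x) = 1"
  using total_weight_pos by (simp add: stationary_def flip: sum_divide_distrib)

lemma stationary_set_eq_1: "stationary_set V \<omega> V = 1"
  by (simp add: stationary_set_def sum_stationary)

lemma stationary_set_pos: "A \<subseteq> V \<Longrightarrow> A \<noteq> {} \<Longrightarrow> 0 < stationary_set V \<omega> A"
  unfolding stationary_set_def using finite_V stationary_pos
  by (intro sum_pos) (auto intro: finite_subset)

lemma stationary_le_1: "x \<in> V \<Longrightarrow> \<pi> x \<le> 1"
  using member_le_sum[of x V \<pi>] finite_V stationary_pos sum_stationary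
  by (auto simp: less_imp_le)

lemma transition_nonneg: "x \<in> V \<Longrightarrow> y \<in> V \<Longrightarrow> 0 \<le> K x y"
  using vertex_weight_pos weight_nonneg by (simp add: transition_def less_imp_le)

lemma transition_row_sum: "x \<in> V \<Longrightarrow> (\<Sum>y\<in>V. K x y) = 1"
  using vertex_weight_pos[of x]
  by (simp add: transition_def vertex_weight_def flip: sum_divide_distrib)

lemma transition_reversible:
  assumes "x \<in> V" "y \<in> V" shows "\<pi> x * K x y = \<pi> y * K y x"
  using vertex_weight_pos assms weight_sym[OF assms]
  by (simp add: transition_def stationary_def less_imp_neq[symmetric])

lemma transition_power_nonneg: "x \<in> V \<Longrightarrow> y \<in> V \<Longrightarrow> 0 \<le> Kpow n x y"
  by (induction n arbitrary: x) (auto intro!: sum_nonneg mult_nonneg_nonneg transition_nonneg)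

lemma transition_power_row_sum: "x \<in> V \<Longrightarrow> (\<Sum>y\<in>V. Kpow n x y) = 1"
proof (induction n arbitrary: x)
  case 0
  then show ?case using finite_V by simp
next
  case (Suc n)
  have "(\<Sum>y\<in>V. Kpow (Suc n) x y) = (\<Sum>z\<in>V. K x z * (\<Sum>y\<in>V. Kpow n z y))"
    unfolding transition_power.simps sum_distrib_left by (rule sum.swap)
  then show ?case using Suc transition_row_sum by simp
qed

lemma transition_power_le_1: "x \<in> V \<Longrightarrow> y \<in> V \<Longrightarrow> Kpow n x y \<le> 1"
  using member_le_sum[of y V "Kpow n x"] finite_V transition_power_nonneg
    transition_power_row_sum by auto

lemma transition_power_add:
  "x \<in> V \<Longrightarrow> Kpow (m + n) x y = (\<Sum>z\<in>V. Kpow m x z * Kpow n z y)"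
proof (induction m arbitrary: x)
  case 0
  have "(\<Sum>z\<in>V. Kpow 0 x z * Kpow n z y) = (\<Sum>z\<in>V. if x = z then Kpow n z y else 0)"
    by (intro sum.cong) auto
  then show ?case using 0 finite_V by simp
next
  case (Suc m)
  have "Kpow (Suc m + n) x y = (\<Sum>w\<in>V. \<Sum>z\<in>V. K x w * (Kpow m w z * Kpow n z y))"
    using Suc.IH by (simp add: sum_distrib_left)
  also have "\<dots> = (\<Sum>z\<in>V. \<Sum>w\<in>V. K x w * (Kpow m w z * Kpow n z y))"
    by (rule sum.swap)
  finally show ?case by (simp add: sum_distrib_right mult.assoc)
qed

lemma transition_power_1: "y \<in> V \<Longrightarrow> Kpow 1 x y = K x y"
  using finite_V by (simp add: if_distrib[of "\<lambda>c. _ * c"] cong: if_cong)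

lemma transition_power_reversible:
  "x \<in> V \<Longrightarrow> y \<in> V \<Longrightarrow> \<pi> x * Kpow n x y = \<pi> y * Kpow n y x"
proof (induction n arbitrary: x y)
  case 0
  then show ?case by auto
next
  case (Suc n)
  have "\<pi> x * Kpow (Suc n) x y = (\<Sum>z\<in>V. \<pi> x * K x z * Kpow n z y)"
    by (simp add: sum_distrib_left mult.assoc)
  also have "\<dots> = (\<Sum>z\<in>V. \<pi> y * (Kpow n y z * Kpow 1 z x))"
  proof (rule sum.cong[OF refl])
    fix z assume z: "z \<in> V"
    have "\<pi> x * K x z * Kpow n z y = K z x * (\<pi> z * Kpow n z y)"
      using transition_reversible[OF Suc.prems(1) z] by simp
    also have "\<dots> = \<pi> y * (Kpow n y z * Kpow 1 z x)"
      unfolding Suc.IH[OF z Suc.prems(2)] transition_power_1[OF Suc.prems(1)] by simp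
    finally show "\<pi> x * K x z * Kpow n z y = \<pi> y * (Kpow n y z * Kpow 1 z x)" .
  qed
  also have "\<dots> = \<pi> y * Kpow (n + 1) y x"
    using transition_power_add[OF Suc.prems(2), of n 1] by (simp add: sum_distrib_left)
  finally show ?case by simp
qed

lemma exists_transition_power_pos:
  assumes "x \<in> V" "y \<in> V" shows "\<exists>n. 0 < Kpow n x y"
proof -
  have "(x, y) \<in> {(u, v). u \<in> V \<and> v \<in> V \<and> 0 < \<omega> u v}\<^sup>*"
    using connected assms by (auto simp: connected_graph_def)
  then show ?thesis
  proof (induction rule: converse_rtrancl_induct)
    case base
    show ?case by (rule exI[of _ 0]) simp
  next
    case (step u z)
    then obtain n where "0 < Kpow n z y" by auto
    moreover have "0 < K u z"
      using step vertex_weight_pos by (auto simp: transition_def)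
    ultimately have "0 < Kpow (Suc n) u y"
      using step finite_V assms transition_nonneg transition_power_nonneg
      by (auto intro!: sum_pos2[of _ z])
    then show ?case ..
  qed
qed

section \<open>The heat semigroup\<close>

lemma heat_series_summable:
  assumes "x \<in> V" "y \<in> V"
  shows "summable (\<lambda>n. norm (t ^ n / fact n * Kpow n x y))"
proof (rule summable_comparison_test)
  show "summable (\<lambda>n. \<bar>t\<bar> ^ n / fact n)"
    using summable_exp[of "\<bar>t\<bar>"] by (simp add: field_simps)
  have "\<bar>t\<bar> ^ n / fact n * Kpow n x y \<le> \<bar>t\<bar> ^ n / fact n" for n
    using transition_power_le_1[OF assms, of n] by (intro mult_left_le) auto
  then show "\<exists>N. \<forall>n\<ge>N. norm (norm (t ^ n / fact n * Kpow n x y)) \<le> \<bar>t\<bar> ^ n / fact n"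
    using transition_power_nonneg[OF assms] by (simp add: abs_mult power_abs)
qed

lemma heat_series_sums:
  assumes "x \<in> V" "y \<in> V"
  shows "(\<lambda>n. t ^ n / fact n * Kpow n x y) sums (exp t * H t x y)"
  using summable_norm_cancel[OF heat_series_summable[OF assms]]
  by (simp add: heat_kernel_def exp_minus sums_iff)

text \<open>
  The entries of the right-hand side are Cauchy products of exponential series in powers of the
  same matrix, so the binomial formula for \<open>s + t\<close> collects them.
\<close>

lemma heat_kernel_semigroup:
  assumes x: "x \<in> V" and y: "y \<in> V"
  shows "H (s + t) x y = (\<Sum>z\<in>V. H s x z * H t z y)"
proof -
  define a where "a s n u v = s ^ n / fact n * Kpow n u v" for s :: real and n u v
  have binomial: "(s + t) ^ n / fact n = (\<Sum>i\<le>n. s ^ i / fact i * (t ^ (n - i) / fact (n - i)))" for n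
    using exp_series_add_commuting[of s t n] by (simp add: divide_inverse mult.commute)
  have conv: "(\<Sum>z\<in>V. \<Sum>i\<le>n. a s i x z * a t (n - i) z y) = a (s + t) n x y" for n
  proof -
    have "(\<Sum>z\<in>V. \<Sum>i\<le>n. a s i x z * a t (n - i) z y)
      = (\<Sum>i\<le>n. s ^ i / fact i * (t ^ (n - i) / fact (n - i)) * (\<Sum>z\<in>V. Kpow i x z * Kpow (n - i) z y))"
      unfolding a_def sum_distrib_left by (subst sum.swap) (simp add: ac_simps)
    also have "\<dots> = (\<Sum>i\<le>n. s ^ i / fact i * (t ^ (n - i) / fact (n - i)) * Kpow n x y)"
      using transition_power_add[OF x] by (intro sum.cong) (simp_all flip: transition_power_add[OF x])
    finally show ?thesis
      unfolding a_def binomial by (simp add: sum_distrib_right)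
  qed
  have "(\<lambda>n. \<Sum>i\<le>n. a s i x z * a t (n - i) z y) sums (exp s * H s x z * (exp t * H t z y))"
    if z: "z \<in> V" for z
    using Cauchy_product_sums[OF heat_series_summable[OF x z, of s] heat_series_summable[OF z y, of t]]
      heat_series_sums[OF x z, of s] heat_series_sums[OF z y, of t]
    by (simp add: a_def sums_iff)
  then have "(\<lambda>n. \<Sum>z\<in>V. \<Sum>i\<le>n. a s i x z * a t (n - i) z y) sums
      (\<Sum>z\<in>V. exp s * H s x z * (exp t * H t z y))"
    by (rule sums_sum)
  then have "(\<lambda>n. a (s + t) n x y) sums (\<Sum>z\<in>V. exp s * H s x z * (exp t * H t z y))"
    by (simp add: conv)
  then have "exp (s + t) * H (s + t) x y = (\<Sum>z\<in>V. exp s * H s x z * (exp t * H t z y))"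
    using heat_series_sums[OF x y, of "s + t"] sums_unique2 by (auto simp: a_def)
  also have "\<dots> = exp (s + t) * (\<Sum>z\<in>V. H s x z * H t z y)"
    by (simp add: sum_distrib_left exp_add ac_simps)
  finally show ?thesis by simp
qed

lemma heat_kernel_0: "x \<in> V \<Longrightarrow> y \<in> V \<Longrightarrow> H 0 x y = (if x = y then 1 else 0)"
  using powser_zero[of "\<lambda>n. Kpow n x y / fact n"] by (simp add: heat_kernel_def ac_simps)

lemma heat_kernel_reversible:
  assumes "x \<in> V" "y \<in> V"
  shows "\<pi> x * H t x y = \<pi> y * H t y x"
proof -
  have "(\<lambda>n. \<pi> x * (t ^ n / fact n * Kpow n x y)) sums (\<pi> x * (exp t * H t x y))"
    by (intro sums_mult heat_series_sums assms)
  moreover have "(\<lambda>n. \<pi> y * (t ^ n / fact n * Kpow n y x)) sums (\<pi> y * (exp t * H t y x))"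
    by (intro sums_mult heat_series_sums assms)
  moreover have "\<pi> x * (t ^ n / fact n * Kpow n x y) = \<pi> y * (t ^ n / fact n * Kpow n y x)" for n
    using transition_power_reversible[OF assms, of n]
    by (metis (no_types, lifting) mult.left_commute)
  ultimately have "\<pi> x * (exp t * H t x y) = \<pi> y * (exp t * H t y x)"
    by (metis (no_types, lifting) sums_cong sums_unique2)
  then show ?thesis by simp
qed

lemma heat_kernel_row_sum:
  assumes x: "x \<in> V" shows "(\<Sum>y\<in>V. H t x y) = 1"
proof -
  have "(\<lambda>n. \<Sum>y\<in>V. t ^ n / fact n * Kpow n x y) sums (\<Sum>y\<in>V. exp t * H t x y)"
    using heat_series_sums x by (intro sums_sum) auto
  moreover have "(\<Sum>y\<in>V. t ^ n / fact n * Kpow n x y) = t ^ n / fact n" for n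
    unfolding sum_distrib_left[symmetric] transition_power_row_sum[OF x] by simp
  moreover have "(\<lambda>n. t ^ n / fact n) sums exp t"
    using exp_converges[of t] by (simp add: field_simps)
  ultimately have "exp t = exp t * (\<Sum>y\<in>V. H t x y)"
    using sums_unique2 by (auto simp: sum_distrib_left)
  then show ?thesis by simp
qed

lemma heat_kernel_stationary: "y \<in> V \<Longrightarrow> (\<Sum>x\<in>V. \<pi> x * H t x y) = \<pi> y"
  using heat_kernel_reversible[of _ y t] heat_kernel_row_sum[of y t]
  by (simp flip: sum_distrib_left)

text \<open>
  This is where connectedness enters: some power of \<open>K\<close> has a positive entry, and at positive
  time the exponential series gives every power a positive weight.
\<close>

lemma heat_kernel_pos:
  assumes "x \<in> V" "y \<in> V" "0 < t" shows "0 < H t x y"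
proof -
  obtain n where "0 < Kpow n x y" using exists_transition_power_pos assms by blast
  then have "0 < (\<Sum>n. t ^ n / fact n * Kpow n x y)"
    using assms transition_power_nonneg heat_series_sums[OF assms(1,2), of t]
    by (intro suminf_pos2[of _ n]) (auto simp: sums_iff)
  then show ?thesis by (simp add: heat_kernel_def)
qed

lemma heat_kernel_deriv_0:
  assumes "x \<in> V" "y \<in> V"
  shows "((\<lambda>t. H t x y) has_real_derivative (K x y - (if x = y then 1 else 0))) (at 0)"
proof -
  define c where "c n = Kpow n x y / fact n" for n
  have summ: "summable (\<lambda>n. c n * t ^ n)" for t
    using heat_series_sums[OF assms, of t] by (simp add: c_def sums_iff ac_simps)
  have "((\<lambda>t. \<Sum>n. c n * t ^ n) has_real_derivative (\<Sum>n. diffs c n * 0 ^ n)) (at 0)"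
    by (rule termdiffs_strong_converges_everywhere[OF summ])
  moreover have "(\<Sum>n. diffs c n * 0 ^ n) = K x y"
    unfolding powser_zero using transition_power_1[OF assms(2), of x]
    by (simp add: diffs_def c_def)
  moreover have "(\<Sum>n. c n * 0 ^ n) = (if x = y then 1 else 0)"
    unfolding powser_zero by (simp add: c_def)
  ultimately have "((\<lambda>t. exp (- t) * (\<Sum>n. c n * t ^ n)) has_real_derivative
      (K x y - (if x = y then 1 else 0))) (at 0)"
    by (auto intro!: derivative_eq_intros)
  moreover have "H t x y = exp (- t) * (\<Sum>n. c n * t ^ n)" for t
    by (simp add: heat_kernel_def c_def ac_simps)
  ultimately show ?thesis by simp
qed

definition heat :: "real \<Rightarrow> ('a \<Rightarrow> real) \<Rightarrow> 'a \<Rightarrow> real" where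
  "heat t f x = (\<Sum>y\<in>V. H t x y * f y)"

lemma heat_0: "x \<in> V \<Longrightarrow> heat 0 f x = f x"
proof -
  assume x: "x \<in> V"
  have "heat 0 f x = (\<Sum>y\<in>V. if x = y then f y else 0)"
    unfolding heat_def using x heat_kernel_0 by (intro sum.cong) auto
  then show ?thesis using x finite_V by simp
qed

lemma heat_add:
  assumes x: "x \<in> V" shows "heat (s + t) f x = heat s (heat t f) x"
proof -
  have "heat (s + t) f x = (\<Sum>y\<in>V. \<Sum>z\<in>V. H s x z * (H t z y * f y))"
    unfolding heat_def using heat_kernel_semigroup[OF x]
    by (intro sum.cong) (auto simp: sum_distrib_right mult.assoc)
  also have "\<dots> = heat s (heat t f) x"
    unfolding heat_def sum_distrib_left by (rule sum.swap)
  finally show ?thesis .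
qed

lemma inner_cong:
  "(\<And>x. x \<in> V \<Longrightarrow> f x = f' x) \<Longrightarrow> (\<And>x. x \<in> V \<Longrightarrow> g x = g' x) \<Longrightarrow> ginner f g = ginner f' g'"
  unfolding graph_inner_def by (intro sum.cong) auto

lemma heat_self_adjoint: "ginner (heat t f) g = ginner f (heat t g)"
proof -
  have "ginner (heat t f) g = (\<Sum>x\<in>V. \<Sum>y\<in>V. \<pi> x * H t x y * (f y * g x))"
    unfolding graph_inner_def heat_def by (simp add: sum_distrib_left sum_distrib_right ac_simps)
  also have "\<dots> = (\<Sum>x\<in>V. \<Sum>y\<in>V. \<pi> y * H t y x * (f y * g x))"
    using heat_kernel_reversible by (intro sum.cong) auto
  also have "\<dots> = (\<Sum>y\<in>V. \<Sum>x\<in>V. \<pi> y * H t y x * (f y * g x))"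
    by (rule sum.swap)
  also have "\<dots> = ginner f (heat t g)"
    unfolding graph_inner_def heat_def by (simp add: sum_distrib_left sum_distrib_right ac_simps)
  finally show ?thesis .
qed

lemma inner_self_nonneg: "0 \<le> ginner f f"
  unfolding graph_inner_def using stationary_pos by (intro sum_nonneg) (simp add: less_imp_le)

lemma inner_self_pos:
  assumes "x \<in> V" "f x \<noteq> 0" shows "0 < ginner f f"
  unfolding graph_inner_def
  using stationary_pos assms finite_V
  by (intro sum_pos2[of _ x]) (auto simp: less_imp_le zero_less_mult_iff)

lemma inner_Cauchy_Schwarz: "(ginner f g)\<^sup>2 \<le> ginner f f * ginner g g"
proof -
  have [simp]: "\<bar>\<pi> x\<bar> = \<pi> x" if "x \<in> V" for x
    using stationary_pos[OF that] by simp
  have eq: "ginner u v = (\<Sum>x\<in>V. (u x * sqrt (\<pi> x)) * (v x * sqrt (\<pi> x)))" for u v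
    unfolding graph_inner_def
    by (intro sum.cong) (simp_all add: mult.assoc mult.left_commute[of "sqrt _"])
  show ?thesis
    unfolding eq using Cauchy_Schwarz_ineq_sum[of "\<lambda>x. f x * sqrt (\<pi> x)" "\<lambda>x. g x * sqrt (\<pi> x)" V]
    by (simp add: power2_eq_square)
qed

lemma inner_heat_deriv_0:
  "((\<lambda>t. ginner (heat t f) f) has_real_derivative - energy f) (at 0)"
proof -
  have heat_deriv: "((\<lambda>t. heat t f x) has_real_derivative - laplacian V \<omega> f x) (at 0)" if x: "x \<in> V" for x
  proof -
    have "((\<lambda>t. heat t f x) has_real_derivative
        (\<Sum>y\<in>V. (K x y - (if x = y then 1 else 0)) * f y)) (at 0)"
      unfolding heat_def by (intro DERIV_sum DERIV_cmult_right heat_kernel_deriv_0 x)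
    also have "(\<Sum>y\<in>V. (K x y - (if x = y then 1 else 0)) * f y)
        = (\<Sum>y\<in>V. K x y * f y) - (\<Sum>y\<in>V. if x = y then f y else 0)"
      unfolding sum_subtractf[symmetric] by (intro sum.cong) (auto simp: algebra_simps)
    also have "\<dots> = - laplacian V \<omega> f x"
      using x finite_V by (simp add: laplacian_def)
    finally show ?thesis .
  qed
  have "((\<lambda>t. ginner (heat t f) f) has_real_derivative
      (\<Sum>x\<in>V. - laplacian V \<omega> f x * f x * \<pi> x)) (at 0)"
    unfolding graph_inner_def by (intro DERIV_sum DERIV_cmult_right heat_deriv)
  then show ?thesis
    by (simp add: graph_inner_def sum_negf)
qed

text \<open>
  Self-adjointness and the semigroup property give
  \<open>\<langle>H\<^sub>s f, f\<rangle> = \<langle>H\<^bsub>s/2\<^esub> f, H\<^bsub>s/2\<^esub> f\<rangle>\<close>, so Cauchy-Schwarz for \<open>H\<^bsub>s/2\<^esub> f\<close> and \<open>f\<close> is exactly the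
  midpoint inequality for \<open>\<phi> s = \<langle>H\<^sub>s f, f\<rangle>\<close>. The slope of \<open>\<phi>\<close> at 0 is minus the energy.
\<close>

lemma inner_heat_ge_exp_energy:
  assumes f: "0 < ginner f f" and t: "0 < t"
  shows "ginner f f * exp (- (t * energy f / ginner f f)) \<le> ginner (heat t f) f"
proof -
  have half: "ginner (heat s f) f = ginner (heat (s / 2) f) (heat (s / 2) f)" for s
  proof -
    have "ginner (heat s f) f = ginner (heat (s / 2) (heat (s / 2) f)) f"
      using heat_add[of _ "s / 2" "s / 2" f] by (intro inner_cong) auto
    then show ?thesis by (simp add: heat_self_adjoint)
  qed
  have zero: "ginner (heat 0 f) f = ginner f f"
    by (intro inner_cong) (auto simp: heat_0)
  have "ginner (heat 0 f) f * exp (t * - energy f / ginner (heat 0 f) f) \<le> ginner (heat t f) f"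
  proof (rule log_convex_above_exp_tangent)
    fix s :: real
    show "(ginner (heat (s / 2) f) f)\<^sup>2 \<le> ginner (heat s f) f * ginner (heat 0 f) f"
      unfolding zero half[of s] by (rule inner_Cauchy_Schwarz)
    show "0 \<le> ginner (heat s f) f"
      unfolding half[of s] by (rule inner_self_nonneg)
  qed (use f t zero inner_heat_deriv_0 in auto)
  then show ?thesis by (simp add: zero)
qed

section \<open>Mixing\<close>

definition mixed :: "real \<Rightarrow> bool" where
  "mixed t \<longleftrightarrow> 0 < t \<and> (\<forall>x\<in>V. \<forall>y\<in>V. \<bar>H t x y - \<pi> y\<bar> \<le> \<pi> y / 2)"

lemma mixing_time_eq: "mixing_time V \<omega> = Inf {t. mixed t}"
proof -
  have "(SUP (x, y) \<in> V \<times> V. \<bar>(H t x y - \<pi> y) / \<pi> y\<bar>) \<le> 1 / 2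
      \<longleftrightarrow> (\<forall>x\<in>V. \<forall>y\<in>V. \<bar>H t x y - \<pi> y\<bar> \<le> \<pi> y / 2)" for t
  proof -
    have "\<bar>(H t x y - \<pi> y) / \<pi> y\<bar> \<le> 1 / 2 \<longleftrightarrow> \<bar>H t x y - \<pi> y\<bar> \<le> \<pi> y / 2" if "y \<in> V" for x y
      using stationary_pos[OF that] by (simp add: abs_divide divide_simps)
    then show ?thesis
      using finite_V nonempty_V by (subst cSUP_le_iff) (auto intro!: bdd_above_finite)
  qed
  then show ?thesis
    unfolding mixing_time_def mixed_def by simp
qed

text \<open>
  Doeblin's argument. The columns of \<open>H - \<Pi>\<close>, where all rows of \<open>\<Pi>\<close> are \<open>\<pi>\<close>, are annihilated by
  \<open>\<pi>\<close>. Subtracting \<open>\<delta> \<Pi>\<close> from \<open>H 1\<close> therefore does not change its action on them, while it leaves a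
  nonnegative matrix with row sums \<open>1 - \<delta>\<close>, which contracts the supremum norm by that factor.
\<close>

lemma heat_kernel_minus_stationary_decay:
  assumes minor: "\<And>x y. x \<in> V \<Longrightarrow> y \<in> V \<Longrightarrow> \<delta> * \<pi> y \<le> H 1 x y"
    and "x \<in> V" "y \<in> V"
  shows "\<bar>H (real n) x y - \<pi> y\<bar> \<le> (1 - \<delta>) ^ n"
  using \<open>x \<in> V\<close>
proof (induction n arbitrary: x)
  case 0
  then show ?case
    using stationary_pos[OF \<open>y \<in> V\<close>] stationary_le_1[OF \<open>y \<in> V\<close>] heat_kernel_0[OF 0 \<open>y \<in> V\<close>]
    by auto
next
  case (Suc n)
  have "(\<Sum>z\<in>V. (H 1 x z - \<delta> * \<pi> z) * (H (real n) z y - \<pi> y))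
      = (\<Sum>z\<in>V. H 1 x z * H (real n) z y) - (\<Sum>z\<in>V. H 1 x z) * \<pi> y
        - \<delta> * (\<Sum>z\<in>V. \<pi> z * H (real n) z y) + \<delta> * (\<Sum>z\<in>V. \<pi> z) * \<pi> y"
    by (simp add: algebra_simps sum.distrib sum_subtractf sum_distrib_left sum_distrib_right)
  also have "\<dots> = H (real (Suc n)) x y - \<pi> y"
    using heat_kernel_semigroup[OF Suc.prems \<open>y \<in> V\<close>, of 1 "real n"]
    by (simp add: heat_kernel_row_sum[OF Suc.prems] heat_kernel_stationary[OF \<open>y \<in> V\<close>] sum_stationary)
  finally have "\<bar>H (real (Suc n)) x y - \<pi> y\<bar>
      = \<bar>\<Sum>z\<in>V. (H 1 x z - \<delta> * \<pi> z) * (H (real n) z y - \<pi> y)\<bar>"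
    by (simp only:)
  also have "\<dots> \<le> (\<Sum>z\<in>V. \<bar>(H 1 x z - \<delta> * \<pi> z) * (H (real n) z y - \<pi> y)\<bar>)"
    by (rule sum_abs)
  also have "\<dots> \<le> (\<Sum>z\<in>V. (H 1 x z - \<delta> * \<pi> z) * (1 - \<delta>) ^ n)"
  proof (rule sum_mono)
    fix z assume z: "z \<in> V"
    show "\<bar>(H 1 x z - \<delta> * \<pi> z) * (H (real n) z y - \<pi> y)\<bar> \<le> (H 1 x z - \<delta> * \<pi> z) * (1 - \<delta>) ^ n"
      unfolding abs_mult using minor[OF Suc.prems z] Suc.IH[OF z] by (intro mult_mono) auto
  qed
  also have "\<dots> = (1 - \<delta>) ^ Suc n"
    unfolding sum_distrib_right[symmetric] sum_subtractf sum_distrib_left[symmetric]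
    using heat_kernel_row_sum[OF Suc.prems] sum_stationary by simp
  finally show ?case .
qed

lemma exists_mixed: "\<exists>t. mixed t"
proof -
  define \<delta> where "\<delta> = Min ((\<lambda>(x, y). H 1 x y) ` (V \<times> V))"
  define p where "p = Min (\<pi> ` V)"
  obtain x0 where x0: "x0 \<in> V" using nonempty_V by auto
  have \<delta>: "0 < \<delta>"
    unfolding \<delta>_def using finite_V nonempty_V heat_kernel_pos by (subst Min_gr_iff) auto
  have \<delta>_le: "\<delta> \<le> H 1 x y" if "x \<in> V" "y \<in> V" for x y
    unfolding \<delta>_def using finite_V that by (intro Min_le) auto
  have minor: "\<delta> * \<pi> y \<le> H 1 x y" if "x \<in> V" "y \<in> V" for x y
  proof -
    have "\<delta> * \<pi> y \<le> \<delta>" using \<delta> stationary_le_1[OF that(2)] by (intro mult_left_le) auto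
    then show ?thesis using \<delta>_le[OF that] by linarith
  qed
  have p: "0 < p"
    unfolding p_def using finite_V nonempty_V stationary_pos by (subst Min_gr_iff) auto
  have p_le: "p \<le> \<pi> y" if "y \<in> V" for y
    unfolding p_def using finite_V that by (intro Min_le) auto
  have "p \<le> 1" using p_le[OF x0] stationary_le_1[OF x0] by linarith
  obtain n where n: "(1 - \<delta>) ^ n < p / 2"
    using real_arch_pow_inv[of "p / 2" "1 - \<delta>"] p \<delta> by auto
  \<comment> \<open>mixing times are positive by definition, so time 0 has to be excluded\<close>
  have "n \<noteq> 0" using n \<open>p \<le> 1\<close> by (cases n) auto
  moreover have "\<bar>H (real n) x y - \<pi> y\<bar> \<le> \<pi> y / 2" if "x \<in> V" "y \<in> V" for x y
    using heat_kernel_minus_stationary_decay[OF minor that, of n] n p_le[OF that(2)] by linarith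
  ultimately have "mixed (real n)" by (simp add: mixed_def)
  then show ?thesis ..
qed

text \<open>
  Lower bounds valid at all mixed times pass to their infimum, as long as one divides by \<open>R\<close>.
  The positivity of \<open>R\<close> comes for free from the existence of a mixed time.
\<close>

lemma mixing_time_transfer:
  assumes c: "0 < c" and bound: "\<And>t. mixed t \<Longrightarrow> c \<le> t * R"
  shows "0 < R" "0 < mixing_time V \<omega>" "c \<le> mixing_time V \<omega> * R"
proof -
  obtain t where t: "mixed t" using exists_mixed by blast
  then have "0 < t * R" using bound c by fastforce
  then show R: "0 < R" using t by (simp add: mixed_def zero_less_mult_iff)
  have "c / R \<le> mixing_time V \<omega>"
    unfolding mixing_time_eq
    using t bound R by (intro cInf_greatest) (auto simp: field_simps)
  moreover have "0 < c / R" using c R by simp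
  ultimately show "0 < mixing_time V \<omega>" "c \<le> mixing_time V \<omega> * R"
    using R by (linarith, simp add: field_simps)
qed

section \<open>Energy lower bounds from mixing\<close>

lemma energy_ge_of_heat_contraction:
  assumes n: "0 < ginner f f" and t: "0 < t" and q: "0 < q"
    and contr: "ginner (heat t f) f \<le> q * ginner f f"
  shows "ln (1 / q) * ginner f f \<le> t * energy f"
proof -
  have "ginner f f * exp (- (t * energy f / ginner f f)) \<le> ginner f f * q"
    using inner_heat_ge_exp_energy[OF n t] contr by (simp add: mult.commute)
  then have "exp (- (t * energy f / ginner f f)) \<le> q"
    using n by simp
  then have "- (t * energy f / ginner f f) \<le> ln q"
    using q by (simp add: ln_ge_iff)
  then have "ln (1 / q) \<le> t * energy f / ginner f f"
    using q by (simp add: ln_div)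
  then show ?thesis using n by (simp add: field_simps)
qed

text \<open>
  For nonnegative \<open>f\<close> this is the bound of the 1-norm by the 2-norm on a set of measure \<open>\<pi>(A)\<close>,
  that is, Cauchy-Schwarz against the indicator function of \<open>A\<close>.
\<close>

lemma mean_square_le:
  assumes A: "A \<subseteq> V" and supp: "{x \<in> V. f x \<noteq> 0} \<subseteq> A"
  shows "(mean f)\<^sup>2 \<le> stationary_set V \<omega> A * ginner f f"
proof -
  have "mean f = ginner (indicator A) f"
    unfolding graph_inner_def using supp by (intro sum.cong) (auto simp: indicator_def)
  moreover have "ginner (indicator A) (indicator A) = stationary_set V \<omega> A"
  proof -
    have "ginner (indicator A) (indicator A) = (\<Sum>x\<in>V. if x \<in> A then \<pi> x else 0)"
      unfolding graph_inner_def by (intro sum.cong) auto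
    also have "\<dots> = (\<Sum>x\<in>V \<inter> A. \<pi> x)"
      using finite_V by (simp add: sum.inter_restrict)
    also have "V \<inter> A = A" using A by auto
    finally show ?thesis by (simp add: stationary_set_def)
  qed
  ultimately show ?thesis
    using inner_Cauchy_Schwarz[of "indicator A" f] by simp
qed

text \<open>
  At a mixed time \<open>H\<^sub>t\<close> has spread the mass of \<open>f\<close> almost uniformly, so only a fraction of order
  \<open>\<pi>(A)\<close> of it is still seen by \<open>f\<close>. Such a drop of \<open>\<langle>H\<^sub>t f, f\<rangle>\<close> requires energy of order
  \<open>ln (1 / \<pi>(A)) / t\<close>. The factor 3/2 is 1 plus the precision 1/2 in the definition of mixing.
\<close>

lemma energy_ge_supported:
  assumes t: "mixed t" and A: "A \<subseteq> V" and supp: "{x \<in> V. f x \<noteq> 0} \<subseteq> A"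
    and nonneg: "\<And>x. x \<in> V \<Longrightarrow> 0 \<le> f x" and n: "0 < ginner f f"
    and r: "stationary_set V \<omega> A \<le> r" "0 < r"
  shows "ln (2 / (3 * r)) * ginner f f \<le> t * energy f"
proof -
  have heat_le: "heat t f x \<le> 3 / 2 * mean f" if x: "x \<in> V" for x
  proof -
    have "heat t f x \<le> (\<Sum>y\<in>V. (3 / 2 * \<pi> y) * f y)"
      unfolding heat_def
    proof (intro sum_mono mult_right_mono nonneg)
      fix y assume "y \<in> V"
      then have "\<bar>H t x y - \<pi> y\<bar> \<le> \<pi> y / 2" using t x by (auto simp: mixed_def)
      then show "H t x y \<le> 3 / 2 * \<pi> y" by linarith
    qed auto
    then show ?thesis by (simp add: sum_distrib_left ac_simps)
  qed
  have "ginner (heat t f) f \<le> (\<Sum>x\<in>V. 3 / 2 * mean f * f x * \<pi> x)"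
    unfolding graph_inner_def using nonneg stationary_pos
    by (intro sum_mono mult_right_mono heat_le) (auto simp: less_imp_le)
  also have "\<dots> = 3 / 2 * mean f * mean f"
    by (simp only: sum_distrib_left[symmetric] mult.assoc)
  also have "\<dots> = 3 / 2 * (mean f)\<^sup>2"
    by (simp add: power2_eq_square)
  also have "\<dots> \<le> 3 / 2 * (r * ginner f f)"
    using mean_square_le[OF A supp] mult_right_mono[OF r(1), of "ginner f f"] n by linarith
  finally have "ginner (heat t f) f \<le> (3 / 2 * r) * ginner f f" by simp
  then have "ln (1 / (3 / 2 * r)) * ginner f f \<le> t * energy f"
    using n t r(2) by (intro energy_ge_of_heat_contraction) (auto simp: mixed_def)
  then show ?thesis by simp
qed

definition centred :: "('a \<Rightarrow> real) \<Rightarrow> 'a \<Rightarrow> real" where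
  "centred f x = f x - mean f"

lemma mean_centred: "mean (centred f) = 0"
  by (simp add: centred_def left_diff_distrib sum_subtractf sum_stationary flip: sum_distrib_left)

lemma inner_centred: "ginner (centred f) (centred f) = ginner f f - (mean f)\<^sup>2"
proof -
  have "ginner (centred f) (centred f)
      = (\<Sum>x\<in>V. f x * f x * \<pi> x - 2 * mean f * (f x * \<pi> x) + (mean f)\<^sup>2 * \<pi> x)"
    unfolding graph_inner_def centred_def
    by (intro sum.cong) (simp_all add: power2_eq_square algebra_simps)
  also have "\<dots> = ginner f f - 2 * mean f * mean f + (mean f)\<^sup>2 * (\<Sum>x\<in>V. \<pi> x)"
    by (simp only: sum.distrib sum_subtractf sum_distrib_left[symmetric] graph_inner_def)
  finally show ?thesis by (simp add: sum_stationary power2_eq_square)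
qed

lemma mean_laplacian: "mean (laplacian V \<omega> f) = 0"
proof -
  have stat: "(\<Sum>x\<in>V. \<pi> x * K x y) = \<pi> y" if y: "y \<in> V" for y
  proof -
    have "(\<Sum>x\<in>V. \<pi> x * K x y) = (\<Sum>x\<in>V. \<pi> y * K y x)"
      using transition_reversible y by (intro sum.cong) auto
    then show ?thesis using transition_row_sum[OF y] by (simp flip: sum_distrib_left)
  qed
  have "(\<Sum>x\<in>V. (\<Sum>y\<in>V. K x y * f y) * \<pi> x) = (\<Sum>y\<in>V. (\<Sum>x\<in>V. \<pi> x * K x y) * f y)"
    unfolding sum_distrib_right by (subst sum.swap) (simp add: ac_simps)
  also have "\<dots> = mean f"
    using stat by (intro sum.cong) auto
  finally show ?thesis
    by (simp add: laplacian_def left_diff_distrib sum_subtractf)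
qed

lemma energy_centred: "energy (centred f) = energy f"
proof -
  have lap: "laplacian V \<omega> (centred f) x = laplacian V \<omega> f x" if "x \<in> V" for x
    using transition_row_sum[OF that]
    by (simp add: laplacian_def centred_def right_diff_distrib sum_subtractf flip: sum_distrib_right)
  have "energy (centred f) = ginner (laplacian V \<omega> f) (centred f)"
    using lap by (intro inner_cong) auto
  also have "\<dots> = energy f - mean f * mean (laplacian V \<omega> f)"
    unfolding graph_inner_def centred_def
    by (simp add: sum_distrib_left right_diff_distrib left_diff_distrib sum_subtractf ac_simps)
  finally show ?thesis by (simp add: mean_laplacian)
qed

text \<open>
  A Poincare inequality with constant \<open>ln 2 / t\<close>. The energy does not see constants, so \<open>f\<close> may be
  centred; then \<open>H\<^sub>t x y\<close> may be replaced by \<open>H\<^sub>t x y - \<pi> y\<close>, which is at most half of \<open>\<pi> y\<close>, and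
  \<open>H\<^sub>t\<close> at least halves the quadratic form.
\<close>

lemma energy_ge_variance:
  assumes t: "mixed t" and var: "0 < ginner f f - (mean f)\<^sup>2"
  shows "ln 2 * (ginner f f - (mean f)\<^sup>2) \<le> t * energy f"
proof -
  define g where "g = centred f"
  define a where "a = mean (\<lambda>x. \<bar>g x\<bar>)"
  have heat_le: "\<bar>heat t g x\<bar> \<le> a / 2" if x: "x \<in> V" for x
  proof -
    have "heat t g x = heat t g x - mean g" by (simp add: g_def mean_centred)
    also have "\<dots> = (\<Sum>y\<in>V. (H t x y - \<pi> y) * g y)"
      unfolding heat_def sum_subtractf[symmetric] by (intro sum.cong) (auto simp: algebra_simps)
    finally have "\<bar>heat t g x\<bar> \<le> (\<Sum>y\<in>V. \<bar>(H t x y - \<pi> y) * g y\<bar>)"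
      by simp
    also have "\<dots> \<le> (\<Sum>y\<in>V. \<pi> y / 2 * \<bar>g y\<bar>)"
      unfolding abs_mult using t x by (intro sum_mono mult_right_mono) (auto simp: mixed_def)
    also have "\<dots> = a / 2"
      by (simp add: a_def sum_divide_distrib mult.commute)
    finally show ?thesis .
  qed
  have "ginner (heat t g) g \<le> (\<Sum>x\<in>V. a / 2 * \<bar>g x\<bar> * \<pi> x)"
    unfolding graph_inner_def
  proof (intro sum_mono mult_right_mono)
    fix x assume x: "x \<in> V"
    have "heat t g x * g x \<le> \<bar>heat t g x\<bar> * \<bar>g x\<bar>" by (simp flip: abs_mult)
    also have "\<dots> \<le> a / 2 * \<bar>g x\<bar>" using heat_le[OF x] by (intro mult_right_mono) auto
    finally show "heat t g x * g x \<le> a / 2 * \<bar>g x\<bar>" .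
  qed (use stationary_pos in \<open>auto simp: less_imp_le\<close>)
  also have "\<dots> = 1 / 2 * a\<^sup>2"
    by (simp add: a_def power2_eq_square sum_distrib_left mult.assoc)
  also have "\<dots> \<le> 1 / 2 * ginner g g"
    using mean_square_le[of V "\<lambda>x. \<bar>g x\<bar>"] by (simp add: a_def stationary_set_eq_1 graph_inner_def)
  finally have "ln (1 / (1 / 2)) * ginner g g \<le> t * energy g"
    using t var by (intro energy_ge_of_heat_contraction) (auto simp: mixed_def g_def inner_centred)
  then show ?thesis by (simp add: g_def inner_centred energy_centred)
qed

section \<open>Lower bound for the spectral profile\<close>

abbreviation "rayleigh f \<equiv>
  energy f / ((Lp_norm V \<omega> 2 f)\<^sup>2 - (Lp_norm V \<omega> 1 f)\<^sup>2)"

lemma rayleigh_eq: "rayleigh f = energy f / (ginner f f - (mean f)\<^sup>2)"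
proof -
  have "(Lp_norm V \<omega> 2 f)\<^sup>2 = ginner f f"
    using inner_self_nonneg[of f]
    by (simp add: Lp_norm_def graph_inner_def power2_eq_square[symmetric])
  moreover have "Lp_norm V \<omega> 1 f = mean f"
    by (simp add: Lp_norm_def)
  ultimately show ?thesis by simp
qed

lemma variance_pos:
  assumes "\<not> f constant_on V" shows "0 < ginner f f - (mean f)\<^sup>2"
proof -
  obtain x where "x \<in> V" "f x \<noteq> mean f"
    using assms by (auto simp: constant_on_def)
  then show ?thesis
    using inner_self_pos[of x "centred f"] by (simp add: inner_centred centred_def)
qed

text \<open>
  With \<open>q = t E f / (\<parallel>f\<parallel>\<^sub>2\<^sup>2 - \<parallel>f\<parallel>\<^sub>1\<^sup>2)\<close> the two energy bounds read \<open>q \<ge> ln 2\<close> and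
  \<open>q \<ge> ln (2 / (3 r))\<close>. Four times the first plus the second is \<open>5 q \<ge> ln (32 / (3 r))\<close>. The weight 4
  makes the right-hand side positive up to \<open>r = 8\<close>, where its value is \<open>ln (4 / 3)\<close>.
\<close>

lemma rayleigh_ge:
  assumes t: "mixed t" and A: "A \<subseteq> V" and f: "f \<in> admissible V A"
    and r: "stationary_set V \<omega> A \<le> r" "0 < r"
  shows "ln (32 / (3 * r)) / 5 \<le> t * rayleigh f"
proof -
  define v where "v = ginner f f - (mean f)\<^sup>2"
  define q where "q = t * energy f / v"
  have v: "0 < v" and v_le: "v \<le> ginner f f"
    using f variance_pos by (auto simp: v_def admissible_def)
  have "ln 2 * v \<le> t * energy f"
    using energy_ge_variance[OF t] v by (simp add: v_def)
  then have gap: "ln 2 \<le> q"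
    using v by (simp add: q_def field_simps)
  \<comment> \<open>replacing the 2-norm by the smaller variance is legitimate only for a nonnegative
      logarithm; a negative one is below \<open>ln 2\<close> anyway\<close>
  have "ln (2 / (3 * r)) \<le> q"
  proof (cases "ln (2 / (3 * r)) \<le> 0")
    case True
    then show ?thesis using gap ln_gt_zero[of 2] by linarith
  next
    case False
    then have "ln (2 / (3 * r)) * v \<le> ln (2 / (3 * r)) * ginner f f"
      using v_le by (intro mult_left_mono) auto
    also have "\<dots> \<le> t * energy f"
      using f v v_le r by (intro energy_ge_supported[OF t A]) (auto simp: admissible_def)
    finally show ?thesis using v by (simp add: q_def field_simps)
  qed
  moreover have "ln (32 / (3 * r)) = 4 * ln 2 + ln (2 / (3 * r))"
  proof -
    have "ln (32 / (3 * r)) = ln (2 ^ 4 * (2 / (3 * r)))" by simp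
    also have "\<dots> = ln (2 ^ 4) + ln (2 / (3 * r))"
      using r by (subst ln_mult) auto
    finally show ?thesis by (simp only: ln_realpow)
  qed
  ultimately have "ln (32 / (3 * r)) / 5 \<le> q" using gap by simp
  then show ?thesis unfolding rayleigh_eq by (simp add: q_def v_def)
qed

text \<open>
  An infimum of real numbers says nothing when it is taken over the empty set, so the lower bounds
  below need a test function for every nonempty set of vertices.
\<close>

lemma indicator_admissible:
  assumes "x \<in> A" "A \<subseteq> V" shows "indicator {x} \<in> admissible V A"
proof -
  obtain y where "y \<in> V" "y \<noteq> x" using exists_other_vertex by auto
  moreover have "indicator {x} x \<noteq> (indicator {x} y :: real)"
    using \<open>y \<noteq> x\<close> by simp
  ultimately have "\<not> (indicator {x} :: 'a \<Rightarrow> real) constant_on V"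
    using assms unfolding constant_on_def by (metis subsetD)
  then show ?thesis
    using assms by (auto simp: admissible_def indicator_def)
qed

lemma ln_profile_bound_pos: "0 < r \<Longrightarrow> r \<le> 8 \<Longrightarrow> 0 < ln (32 / (3 * r))" for r :: real
  by (intro ln_gt_zero) (simp add: field_simps)

lemma mixing_time_pos: "0 < mixing_time V \<omega>"
proof -
  obtain x where x: "x \<in> V" using nonempty_V by auto
  show ?thesis
    by (rule mixing_time_transfer(2)[OF _ rayleigh_ge[where r = 1 and A = V]])
      (use ln_profile_bound_pos[of 1] indicator_admissible[OF x] stationary_set_eq_1 in auto)
qed

lemma spectral_profile_ge:
  assumes r: "min_stationary V \<omega> \<le> r" "0 < r" "r \<le> 8"
  shows "ln (32 / (3 * r)) / (5 * mixing_time V \<omega>) \<le> spectral_profile V \<omega> r"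
  unfolding spectral_profile_def
proof (rule cINF_greatest)
  have fin: "finite {A. A \<subseteq> V \<and> A \<noteq> {}}" using finite_V by simp
  have "{A. A \<subseteq> V \<and> A \<noteq> {}} \<noteq> {}" using nonempty_V by auto
  then have "min_stationary V \<omega> \<in> stationary_set V \<omega> ` {A. A \<subseteq> V \<and> A \<noteq> {}}"
    unfolding min_stationary_def using fin by (intro Min_in) auto
  then obtain A where A: "A \<subseteq> V" "A \<noteq> {}" "min_stationary V \<omega> = stationary_set V \<omega> A"
    by blast
  then show "{A. A \<subseteq> V \<and> 0 < stationary_set V \<omega> A \<and> stationary_set V \<omega> A \<le> r} \<noteq> {}"
    using r stationary_set_pos[of A] by auto
next
  fix A assume A: "A \<in> {A. A \<subseteq> V \<and> 0 < stationary_set V \<omega> A \<and> stationary_set V \<omega> A \<le> r}"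
  then have "A \<noteq> {}" by (auto simp: stationary_set_def)
  then obtain x where x: "x \<in> A" by auto
  show "ln (32 / (3 * r)) / (5 * mixing_time V \<omega>) \<le> set_lambda V \<omega> A"
    unfolding set_lambda_def
  proof (rule cINF_greatest)
    show "admissible V A \<noteq> {}" using indicator_admissible[OF x] A by blast
  next
    fix f assume f: "f \<in> admissible V A"
    have "ln (32 / (3 * r)) / 5 \<le> mixing_time V \<omega> * rayleigh f"
      by (rule mixing_time_transfer(3)[OF _ rayleigh_ge])
        (use ln_profile_bound_pos[of r] A f r in auto)
    then show "ln (32 / (3 * r)) / (5 * mixing_time V \<omega>) \<le> rayleigh f"
      using mixing_time_pos by (simp add: field_simps)
  qed
qed

section \<open>The integral\<close>

text \<open>
  The upper bound keeps \<open>4 p\<close> below 8, hence the interval of integration nondegenerate, and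
  \<open>ln (1 / p)\<close> away from 0.
\<close>

lemma min_stationary_bounds: "0 < min_stationary V \<omega>" "min_stationary V \<omega> \<le> 1 / 2"
proof -
  have fin: "finite {A. A \<subseteq> V \<and> A \<noteq> {}}" using finite_V by simp
  have ne: "{A. A \<subseteq> V \<and> A \<noteq> {}} \<noteq> {}" using nonempty_V by auto
  show "0 < min_stationary V \<omega>"
    unfolding min_stationary_def using fin ne stationary_set_pos by (subst Min_gr_iff) auto
  obtain x where x: "x \<in> V" using nonempty_V by auto
  obtain y where y: "y \<in> V" "y \<noteq> x" using exists_other_vertex by auto
  have le: "min_stationary V \<omega> \<le> \<pi> z" if "z \<in> V" for z
    unfolding min_stationary_def
    using fin that by (intro Min_le) (auto simp: stationary_set_def intro!: image_eqI[of _ _ "{z}"])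
  have "\<pi> x + \<pi> y = (\<Sum>z\<in>{x, y}. \<pi> z)" using y by simp
  also have "\<dots> \<le> (\<Sum>z\<in>V. \<pi> z)"
    using x y finite_V stationary_pos by (intro sum_mono2) (auto simp: less_imp_le)
  finally show "min_stationary V \<omega> \<le> 1 / 2"
    using le[OF x] le[OF y(1)] sum_stationary by linarith
qed

text \<open>
  The antiderivative of \<open>1 / (r ln (32 / (3 r)))\<close> is \<open>- ln (ln (32 / (3 r)))\<close>. The comparison
  \<open>integral_mono'\<close> takes integrability from the majorant alone, so the spectral profile enters only
  through its pointwise lower bound.
\<close>

lemma spectral_profile_integral_le:
  "spectral_profile_integral V \<omega>
    \<le> 10 * mixing_time V \<omega> * (ln (ln (8 / (3 * min_stationary V \<omega>))) - ln (ln (4 / 3)))"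
proof -
  define p where "p = min_stationary V \<omega>"
  define \<tau> where "\<tau> = mixing_time V \<omega>"
  define h where "h r = 10 * \<tau> * (1 / (r * ln (32 / (3 * r))))" for r
  define F where "F r = - (10 * \<tau> * ln (ln (32 / (3 * r))))" for r
  have p: "0 < p" "p \<le> 1 / 2" using min_stationary_bounds by (auto simp: p_def)
  have \<tau>: "0 < \<tau>" using mixing_time_pos by (simp add: \<tau>_def)
  have ln_pos: "0 < ln (32 / (3 * r))" if "4 * p \<le> r" "r \<le> 8" for r
    using ln_profile_bound_pos[of r] that p by auto
  have FTC: "has_bochner_integral lborel (\<lambda>r. h r * indicator {4 * p..8} r) (F 8 - F (4 * p))"
  proof (rule has_bochner_integral_FTC_Icc_real)
    show "4 * p \<le> 8" using p by simp
    fix r assume r: "4 * p \<le> r" "r \<le> 8"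
    then have "0 < r" using p by simp
    show "(F has_real_derivative h r) (at r)"
      unfolding F_def h_def
      using ln_pos[OF r] \<open>0 < r\<close> by (auto intro!: derivative_eq_intros simp: field_simps)
    show "isCont h r"
      unfolding h_def using ln_pos[OF r] \<open>0 < r\<close> by (intro continuous_intros) auto
  qed
  have "spectral_profile_integral V \<omega>
      = (\<integral>r. indicator {4 * p..8} r *\<^sub>R (2 / (r * spectral_profile V \<omega> r)) \<partial>lborel)"
    by (simp add: spectral_profile_integral_def set_lebesgue_integral_def p_def)
  also have "\<dots> \<le> (\<integral>r. h r * indicator {4 * p..8} r \<partial>lborel)"
  proof (rule integral_mono')
    show "integrable lborel (\<lambda>r. h r * indicator {4 * p..8} r)"
      using FTC by (rule integrable.intros)
    fix r :: real
    show "indicator {4 * p..8} r *\<^sub>R (2 / (r * spectral_profile V \<omega> r)) \<le> h r * indicator {4 * p..8} r"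
    proof (cases "r \<in> {4 * p..8}")
      case True
      then have r: "4 * p \<le> r" "r \<le> 8" "0 < r" using p by auto
      define b where "b = ln (32 / (3 * r))"
      have b: "0 < b" using ln_pos r by (simp add: b_def)
      have "b / (5 * \<tau>) \<le> spectral_profile V \<omega> r"
        unfolding b_def \<tau>_def using r p by (intro spectral_profile_ge) (auto simp: p_def)
      then have "2 / (r * spectral_profile V \<omega> r) \<le> 2 / (r * (b / (5 * \<tau>)))"
        using r b \<tau> by (intro divide_left_mono mult_left_mono mult_pos_pos)
          (auto intro: less_le_trans[of _ "b / (5 * \<tau>)"])
      also have "\<dots> = h r"
        using r b \<tau> unfolding h_def b_def[symmetric] by simp
      finally show ?thesis using True by simp
    qed simp
    show "0 \<le> h r * indicator {4 * p..8} r"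
      using ln_pos[of r] p \<tau> by (auto simp: h_def indicator_def)
  qed
  also have "\<dots> = F 8 - F (4 * p)"
    using FTC by (rule has_bochner_integral_integral_eq)
  also have "\<dots> = 10 * \<tau> * (ln (ln (8 / (3 * p))) - ln (ln (4 / 3)))"
    by (simp add: F_def right_diff_distrib)
  finally show ?thesis by (simp add: p_def \<tau>_def)
qed

end

text \<open>
  With \<open>M = max 1 (ln (ln (1 / p)))\<close>, both \<open>ln (1 / p)\<close> and \<open>ln (8 / 3)\<close> are at most \<open>exp M\<close>, so
  the first term is at most \<open>ln 2 + M\<close>. As \<open>ln (4 / 3) \<ge> 1 / 4\<close>, the second contributes at most
  \<open>ln 4\<close>. Both constants are absorbed by \<open>M \<ge> 1\<close>.
\<close>

lemma ln_ln_shift_le: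
  fixes p :: real
  assumes p: "0 < p" "p \<le> 1 / 2"
  shows "ln (ln (8 / (3 * p))) - ln (ln (4 / 3)) \<le> 4 * max 1 (ln (ln (1 / p)))"
proof -
  define M where "M = max 1 (ln (ln (1 / p)))"
  have ln2: "ln 2 \<le> (1 :: real)" using ln_le_minus_one[of 2] by simp
  have L: "0 < ln (1 / p)" using p by (intro ln_gt_zero) (simp add: field_simps)
  have "ln (1 / p) = exp (ln (ln (1 / p)))" using L by simp
  also have "\<dots> \<le> exp M" by (simp add: M_def)
  finally have "ln (1 / p) \<le> exp M" .
  moreover have "ln (8 / 3) \<le> exp M"
  proof -
    have "ln (8 / 3) \<le> (8 / 3 - 1 :: real)" by (intro ln_le_minus_one) simp
    also have "\<dots> \<le> 1 + 1" by simp
    also have "\<dots> \<le> exp 1" by (rule exp_ge_add_one_self)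
    also have "\<dots> \<le> exp M" by (simp add: M_def)
    finally show ?thesis .
  qed
  moreover have split: "ln (8 / (3 * p)) = ln (8 / 3) + ln (1 / p)"
    using p ln_mult[of "8 / 3" "1 / p"] by simp
  ultimately have "ln (8 / (3 * p)) \<le> 2 * exp M" by simp
  moreover have "0 < ln (8 / (3 * p))"
    unfolding split using L ln_gt_zero[of "8 / 3"] by linarith
  ultimately have "ln (ln (8 / (3 * p))) \<le> ln (2 * exp M)" by simp
  also have "\<dots> = ln 2 + M" by (simp add: ln_mult)
  finally have upper: "ln (ln (8 / (3 * p))) \<le> 1 + M" using ln2 by simp
  have "1 - 1 / (4 / 3) \<le> ln (4 / 3 :: real)"
    using ln_le_minus_one[of "3 / 4 :: real"] by (simp add: ln_div)
  then have "ln (1 / 4) \<le> ln (ln (4 / 3 :: real))" by simp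
  moreover have "ln (1 / 4) = - (2 * ln (2 :: real))"
    using ln_realpow[of "2 :: real" 2] by (simp add: ln_div)
  ultimately have "- ln (ln (4 / 3 :: real)) \<le> 2" using ln2 by simp
  moreover have "1 \<le> M" by (simp add: M_def)
  ultimately show ?thesis using upper by (simp add: M_def[symmetric])
qed

theorem theorem1:
  "\<exists>C>0. \<forall>(V :: nat set) (\<omega> :: nat \<Rightarrow> nat \<Rightarrow> real).
     weighted_graph V \<omega> \<and> connected_graph V \<omega> \<and> 2 \<le> card V \<longrightarrow>
     spectral_profile_integral V \<omega>
       < C * mixing_time V \<omega> * max 1 (ln (ln (1 / min_stationary V \<omega>)))"
  \<comment> \<open>the factors 10 and 4 of the two bounds give 40; strictness needs a little more\<close>
proof (intro exI[of _ 41] conjI allI impI)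
  fix V :: "nat set" and \<omega> :: "nat \<Rightarrow> nat \<Rightarrow> real"
  assume *: "weighted_graph V \<omega> \<and> connected_graph V \<omega> \<and> 2 \<le> card V"
  then interpret connected_weighted_graph V \<omega>
    by (simp add: connected_weighted_graph_def connected_weighted_graph_axioms_def)
  define M where "M = max 1 (ln (ln (1 / min_stationary V \<omega>)))"
  note spectral_profile_integral_le
  also have "10 * mixing_time V \<omega> * (ln (ln (8 / (3 * min_stationary V \<omega>))) - ln (ln (4 / 3)))
      \<le> 10 * mixing_time V \<omega> * (4 * M)"
    unfolding M_def using mixing_time_pos
    by (intro mult_left_mono ln_ln_shift_le min_stationary_bounds) auto
  also have "\<dots> < 41 * mixing_time V \<omega> * M"
    using mixing_time_pos by (simp add: M_def)
  finally show "spectral_profile_integral V \<omega>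
      < 41 * mixing_time V \<omega> * max 1 (ln (ln (1 / min_stationary V \<omega>)))"
    by (simp add: M_def)
qed simp

end
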